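(* Let $n\ge 2$. For every domain $D\subsetneq\mathbb{R}^n$ and all $x,y\in D$, $$\eta_D(x,y)\le u_D(x,y)\le 2\,\eta_D(x,y)+2\log 3.$$ The (multiplicative) constant $1$ in the left-hand inequality and the additive constant $2\log 3$ in the right-hand inequality are best possible, i.e. $1$ is the largest constant $c$ such that $c\,\eta_D(x,y)\le u_D(x,y)$ for all domains $D\subsetneq\mathbb{R}^n$ and $x,y\in D$, and $2\log 3$ is the smallest constant $C$ such that $u_D(x,y)\le 2\eta_D(x,y)+C$ for all domains $D\subsetneq\mathbb{R}^n$ and $x,y\in D$.
   Context: A domain is a nonempty open connected set. For a domain $D\subsetneq\mathbb{R}^n$ and $x\in D$, $d(x)$ denotes the Euclidean distance from $x$ to $\partial D$. The Gromov hyperbolic metric $u_D$ is $$u_D(x,y)=2\log\frac{|x-y|+\max\{d(x),d(y)\}}{\sqrt{d(x)\,d(y)}},\qquad x,y\in D.$$ The half-Apollonian metric (in general a pseudo-metric) is $$\eta_D(x,y)=\sup_{p\in\partial D}\left|\log\frac{|x-p|}{|y-p|}\right|,\qquad x,y\in D.$$ *)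

theory Defs
  imports "HOL-Analysis.Analysis"
begin

definition proper_domain :: "'a::euclidean_space set \<Rightarrow> bool" where
  "proper_domain D \<longleftrightarrow> D \<noteq> {} \<and> open D \<and> connected D \<and> D \<noteq> UNIV"

definition bdist :: "'a::euclidean_space set \<Rightarrow> 'a \<Rightarrow> real" where
  "bdist D x = infdist x (frontier D)"

definition gromov_u :: "'a::euclidean_space set \<Rightarrow> 'a \<Rightarrow> 'a \<Rightarrow> real" where
  "gromov_u D x y =
     2 * ln ((dist x y + max (bdist D x) (bdist D y)) / sqrt (bdist D x * bdist D y))"

(* The supremum is taken in the reals. For a proper domain D and x, y in D it is the true
   supremum: the frontier of D is nonempty, and each term is at most
   ln (1 + dist x y / min (bdist D x) (bdist D y)). *)
definition half_apollonian :: "'a::euclidean_space set \<Rightarrow> 'a \<Rightarrow> 'a \<Rightarrow> real" where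
  "half_apollonian D x y = (SUP p\<in>frontier D. \<bar>ln (dist x p / dist y p)\<bar>)"

end

theory Submission
  imports Defs
begin

text \<open>
  Write \<open>a\<close>, \<open>b\<close> for the boundary distances of \<open>x\<close>, \<open>y\<close> and \<open>t\<close> for \<open>dist x y\<close>.

  For the lower bound, the triangle inequality gives \<open>dist x p \<le> t + dist y p\<close>, and
  \<open>dist y p \<ge> b\<close>, so each quotient \<open>dist x p / dist y p\<close> is at most \<open>(t + b) / b\<close>, which is in
  turn at most \<open>(t + max a b)\<^sup>2 / (a * b)\<close>, the exponential of the Gromov metric. The same holds
  with \<open>x\<close> and \<open>y\<close> interchanged (lemma \<open>abs_ln_quotient_le_gromov_u\<close>).

  For the upper bound it is enough to look at one boundary point. Let \<open>b \<le> a\<close>, let \<open>p\<close> be a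
  boundary point nearest to \<open>y\<close>, and put \<open>s = dist x p\<close>. Then \<open>s\<close> dominates both \<open>a\<close> and \<open>b\<close>, and
  \<open>t \<le> s + b\<close>. Hence \<open>(t + a) / sqrt (a * b) \<le> (s + a + b) / b \<le> 3 * (s / b)\<close>, where
  \<open>ln (s / b)\<close> is one of the terms of the supremum (lemma \<open>gromov_u_le_half_apollonian\<close>).

  Both constants are seen to be optimal in the punctured space, which is connected since the
  dimension is at least 2, and where both metrics have closed forms because the boundary is a
  single point. Antipodal points on a sphere about the puncture have half-Apollonian distance
  \<open>0\<close> and Gromov distance \<open>2 * ln 3\<close>, so the additive constant is attained. Points \<open>r *\<^sub>R e\<close> and
  \<open>e\<close> on a ray have half-Apollonian distance \<open>ln r\<close> and Gromov distance at most
  \<open>ln r + 2 * ln 2\<close>, so the quotient of the two metrics tends to \<open>1\<close> as \<open>r\<close> grows.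
\<close>

section \<open>Boundary distance in a proper domain\<close>

lemma frontier_nonempty_proper_domain:
  assumes "proper_domain D"
  shows "frontier D \<noteq> {}"
  using assms frontier_eq_empty[of D] by (auto simp: proper_domain_def)

lemma bdist_le_dist:
  assumes "p \<in> frontier D"
  shows "bdist D x \<le> dist x p"
  using assms by (simp add: bdist_def infdist_le)

lemma bdist_pos:
  assumes "proper_domain D" "x \<in> D"
  shows "bdist D x > 0"
proof -
  have "x \<notin> frontier D"
    using assms by (simp add: proper_domain_def frontier_def interior_open)
  then have "bdist D x \<noteq> 0"
    using in_closed_iff_infdist_zero[OF frontier_closed frontier_nonempty_proper_domain[OF assms(1)]]
    by (simp add: bdist_def)
  then show ?thesis
    using infdist_nonneg[of x "frontier D"] by (simp add: bdist_def)
qed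

lemma nearest_frontier_point:
  assumes "proper_domain D"
  obtains p where "p \<in> frontier D" "dist x p = bdist D x"
  using infdist_attains_inf[OF frontier_closed frontier_nonempty_proper_domain[OF assms], of x]
  by (metis bdist_def)

section \<open>The two inequalities\<close>

lemma gromov_u_commute: "gromov_u D x y = gromov_u D y x"
  by (simp add: gromov_u_def dist_commute max.commute mult.commute)

lemma gromov_u_eq_ln:
  assumes "bdist D x > 0" "bdist D y > 0"
  shows "gromov_u D x y =
    ln ((dist x y + max (bdist D x) (bdist D y))\<^sup>2 / (bdist D x * bdist D y))"
proof -
  define T where "T = dist x y + max (bdist D x) (bdist D y)"
  have "T > 0"
    unfolding T_def using assms by (intro add_nonneg_pos) auto
  then have "ln ((T / sqrt (bdist D x * bdist D y))\<^sup>2) = 2 * ln (T / sqrt (bdist D x * bdist D y))"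
    using assms by (simp add: ln_realpow)
  then show ?thesis
    using assms by (simp add: gromov_u_def T_def power_divide)
qed

lemma ln_quotient_le_gromov_u:
  assumes D: "proper_domain D" "x \<in> D" "y \<in> D" and p: "p \<in> frontier D"
  shows "ln (dist x p / dist y p) \<le> gromov_u D x y"
proof -
  define a b t where "a = bdist D x" and "b = bdist D y" and "t = dist x y"
  have a: "0 < a" "a \<le> dist x p" and b: "0 < b" "b \<le> dist y p"
    unfolding a_def b_def using D bdist_pos bdist_le_dist[OF p] by auto
  have t: "0 \<le> t" by (simp add: t_def)
  have "dist x p / dist y p \<le> (t + dist y p) / dist y p"
    using dist_triangle[of x p y] b by (intro divide_right_mono) (auto simp: t_def)
  also have "\<dots> \<le> (t + b) / b"
    using b t by (auto simp: add_divide_distrib intro!: frac_le)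
  also have "\<dots> \<le> (t + max a b)\<^sup>2 / (a * b)"
  proof -
    have "(t + b) * a \<le> (t + max a b) * (t + max a b)"
      using a b t by (intro mult_mono) auto
    then have "(t + b) * a / (a * b) \<le> (t + max a b)\<^sup>2 / (a * b)"
      using a b by (intro divide_right_mono) (auto simp: power2_eq_square)
    then show ?thesis
      using a by simp
  qed
  finally have "ln (dist x p / dist y p) \<le> ln ((t + max a b)\<^sup>2 / (a * b))"
    using a b by (intro ln_mono divide_pos_pos) linarith+
  then show ?thesis
    using gromov_u_eq_ln[of D x y] a b by (simp add: a_def b_def t_def)
qed

text \<open>
  Besides giving the lower bound, this shows that the terms of the supremum are bounded above,
  so that every one of them is at most the supremum.
\<close>

lemma abs_ln_quotient_le_gromov_u:
  assumes D: "proper_domain D" "x \<in> D" "y \<in> D" and p: "p \<in> frontier D"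
  shows "\<bar>ln (dist x p / dist y p)\<bar> \<le> gromov_u D x y"
proof -
  have "0 < dist x p" "0 < dist y p"
    using D bdist_pos bdist_le_dist[OF p] by (meson less_le_trans)+
  then have "ln (dist y p / dist x p) = - ln (dist x p / dist y p)"
    by (simp add: ln_div)
  then show ?thesis
    using ln_quotient_le_gromov_u[OF D p] ln_quotient_le_gromov_u[OF D(1,3,2) p]
    by (simp add: gromov_u_commute[of D y x])
qed

lemma half_apollonian_le_gromov_u:
  assumes "proper_domain D" "x \<in> D" "y \<in> D"
  shows "half_apollonian D x y \<le> gromov_u D x y"
  unfolding half_apollonian_def
  using assms by (intro cSUP_least frontier_nonempty_proper_domain abs_ln_quotient_le_gromov_u)

lemma abs_ln_quotient_le_half_apollonian:
  assumes "proper_domain D" "x \<in> D" "y \<in> D" "p \<in> frontier D"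
  shows "\<bar>ln (dist x p / dist y p)\<bar> \<le> half_apollonian D x y"
  unfolding half_apollonian_def
proof (rule cSUP_upper[OF assms(4)])
  show "bdd_above ((\<lambda>p. \<bar>ln (dist x p / dist y p)\<bar>) ` frontier D)"
    using assms(1-3) abs_ln_quotient_le_gromov_u by (intro bdd_aboveI2)
qed

lemma half_apollonian_commute:
  assumes "proper_domain D" "x \<in> D" "y \<in> D"
  shows "half_apollonian D x y = half_apollonian D y x"
  unfolding half_apollonian_def
proof (rule SUP_cong)
  fix p assume p: "p \<in> frontier D"
  have "0 < dist x p" "0 < dist y p"
    using assms bdist_pos bdist_le_dist[OF p] by (meson less_le_trans)+
  then show "\<bar>ln (dist x p / dist y p)\<bar> = \<bar>ln (dist y p / dist x p)\<bar>"
    by (simp add: ln_div abs_minus_commute)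
qed simp

lemma gromov_u_le_half_apollonian_of_bdist_le:
  assumes D: "proper_domain D" "x \<in> D" "y \<in> D" and le: "bdist D y \<le> bdist D x"
  shows "gromov_u D x y \<le> 2 * half_apollonian D x y + 2 * ln 3"
proof -
  define a b t where "a = bdist D x" and "b = bdist D y" and "t = dist x y"
  obtain p where p: "p \<in> frontier D" "dist y p = b"
    unfolding b_def by (rule nearest_frontier_point[OF D(1)])
  define s where "s = dist x p"
  have pos: "0 < a" "0 < b" "b \<le> a" "a \<le> s" "0 \<le> t"
    unfolding a_def b_def s_def t_def using D le bdist_pos bdist_le_dist[OF p(1)] by auto
  have "t \<le> s + b"
    using dist_triangle2[of x y p] p by (simp add: s_def t_def)
  then have num: "t + a \<le> 3 * s"
    using pos by simp
  have den: "b \<le> sqrt (a * b)"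
    using pos by (intro real_le_rsqrt) (simp add: power2_eq_square)
  have "(t + a) / sqrt (a * b) \<le> 3 * s / b"
    using num den pos by (intro frac_le) auto
  then have "ln ((t + a) / sqrt (a * b)) \<le> ln (3 * (s / b))"
    using pos by (intro ln_mono) auto
  also have "\<dots> = ln 3 + ln (s / b)"
    using pos by (intro ln_mult_pos) auto
  also have "ln (s / b) \<le> half_apollonian D x y"
    using abs_ln_quotient_le_half_apollonian[OF D p(1)] p(2) by (simp add: s_def)
  finally show ?thesis
    using le by (simp add: gromov_u_def a_def b_def t_def max_def)
qed

lemma gromov_u_le_half_apollonian:
  assumes "proper_domain D" "x \<in> D" "y \<in> D"
  shows "gromov_u D x y \<le> 2 * half_apollonian D x y + 2 * ln 3"
proof (cases "bdist D y \<le> bdist D x")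
  case True
  with assms show ?thesis
    by (rule gromov_u_le_half_apollonian_of_bdist_le)
next
  case False
  then have "gromov_u D y x \<le> 2 * half_apollonian D y x + 2 * ln 3"
    using assms by (intro gromov_u_le_half_apollonian_of_bdist_le) auto
  with assms show ?thesis
    by (simp add: gromov_u_commute[of D x y] half_apollonian_commute[of D x y])
qed

section \<open>The punctured space\<close>

lemma proper_domain_punctured:
  assumes "2 \<le> DIM('a::euclidean_space)"
  shows "proper_domain (- {0::'a})"
proof -
  obtain e :: 'a where "norm e = 1"
    using vector_choose_size[of 1] by auto
  then have "- {0::'a} \<noteq> {}"
    by auto
  with assms show ?thesis
    by (auto simp: proper_domain_def connected_punctured_universe)
qed

lemma frontier_punctured: "frontier (- {0::'a::euclidean_space}) = {0}"
  by (simp add: frontier_def closure_complement interior_complement)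

lemma bdist_punctured: "bdist (- {0}) x = norm x"
  by (simp add: bdist_def frontier_punctured del: frontier_complement)

lemma half_apollonian_punctured: "half_apollonian (- {0}) x y = \<bar>ln (norm x / norm y)\<bar>"
  by (simp add: half_apollonian_def frontier_punctured del: frontier_complement)

lemma gromov_u_punctured:
  "gromov_u (- {0}) x y = 2 * ln ((dist x y + max (norm x) (norm y)) / sqrt (norm x * norm y))"
  by (simp add: gromov_u_def bdist_punctured)

lemma half_apollonian_punctured_ray:
  assumes "norm e = 1" "1 \<le> r"
  shows "half_apollonian (- {0}) (r *\<^sub>R e) e = ln r"
  using assms by (simp add: half_apollonian_punctured)

lemma gromov_u_punctured_ray_le:
  assumes e: "norm e = 1" and r: "1 \<le> r"
  shows "gromov_u (- {0}) (r *\<^sub>R e) e \<le> ln r + 2 * ln 2"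
proof -
  have "r *\<^sub>R e - e = (r - 1) *\<^sub>R e"
    by (simp add: algebra_simps)
  then have "dist (r *\<^sub>R e) e = r - 1"
    using e r by (simp add: dist_norm)
  then have "gromov_u (- {0}) (r *\<^sub>R e) e = 2 * ln ((2 * r - 1) / sqrt r)"
    using e r by (simp add: gromov_u_punctured max_def)
  also have "\<dots> \<le> 2 * ln (2 * r / sqrt r)"
    using r by (intro mult_left_mono ln_mono divide_right_mono) auto
  also have "\<dots> = ln r + 2 * ln 2"
    using r by (simp add: ln_div ln_mult ln_sqrt)
  finally show ?thesis .
qed

text \<open>
  On a ray the assumed inequality gives \<open>c * R \<le> R + 2 * ln 2\<close> for every \<open>R = ln r \<ge> 0\<close>, which
  bounds the slope \<open>c\<close>.
\<close>

lemma multiplicative_constant_le_1: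
  fixes c :: real
  assumes "\<And>x y :: 'a::euclidean_space. x \<noteq> 0 \<Longrightarrow> y \<noteq> 0 \<Longrightarrow>
    c * half_apollonian (- {0}) x y \<le> gromov_u (- {0}) x y"
  shows "c \<le> 1"
proof (rule ccontr)
  assume "\<not> c \<le> 1"
  then have c: "c > 1" by simp
  obtain e :: 'a where e: "norm e = 1"
    using vector_choose_size[of 1] by auto
  \<comment> \<open>The threshold \<open>2 * ln 2 / (c - 1)\<close> is where the two lines meet; twice that value lies
    beyond it.\<close>
  define R where "R = 4 * ln 2 / (c - 1)"
  have R: "R > 0" "(c - 1) * R = 4 * ln 2"
    using c by (auto simp: R_def)
  have "e \<noteq> 0" using e by auto
  then have "c * half_apollonian (- {0}) (exp R *\<^sub>R e) e \<le> gromov_u (- {0}) (exp R *\<^sub>R e) e"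
    by (intro assms) auto
  also have "\<dots> \<le> R + 2 * ln 2"
    using gromov_u_punctured_ray_le[OF e, of "exp R"] R by simp
  finally have "(c - 1) * R \<le> 2 * ln 2"
    using half_apollonian_punctured_ray[OF e, of "exp R"] R by (simp add: algebra_simps)
  with R(2) show False
    by simp
qed

lemma half_apollonian_punctured_antipodal:
  "half_apollonian (- {0}) x (- x) = 0"
  by (cases "x = 0") (auto simp: half_apollonian_punctured)

lemma gromov_u_punctured_antipodal:
  assumes "norm e = 1"
  shows "gromov_u (- {0}) e (- e) = 2 * ln 3"
proof -
  have "e - - e = 2 *\<^sub>R e"
    by (simp add: scaleR_2)
  then have "dist e (- e) = 2"
    using assms by (simp add: dist_norm)
  then show ?thesis
    using assms by (simp add: gromov_u_punctured)
qed

lemma additive_constant_ge: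
  fixes C :: real
  assumes "\<And>x y :: 'a::euclidean_space. x \<noteq> 0 \<Longrightarrow> y \<noteq> 0 \<Longrightarrow>
    gromov_u (- {0}) x y \<le> 2 * half_apollonian (- {0}) x y + C"
  shows "2 * ln 3 \<le> C"
proof -
  obtain e :: 'a where e: "norm e = 1"
    using vector_choose_size[of 1] by auto
  then have "e \<noteq> 0" by auto
  then show ?thesis
    using assms[of e "- e"] e
    by (simp add: gromov_u_punctured_antipodal half_apollonian_punctured_antipodal)
qed

section \<open>The sharp comparison\<close>

theorem theorem5p4:
  assumes "CARD('n::finite) \<ge> 2"
  shows "(\<forall>(D :: (real^'n) set) x y. proper_domain D \<longrightarrow> x \<in> D \<longrightarrow> y \<in> D \<longrightarrow>
            half_apollonian D x y \<le> gromov_u D x y \<and>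
            gromov_u D x y \<le> 2 * half_apollonian D x y + 2 * ln 3)
       \<and> (\<forall>c::real.
            (\<forall>(D :: (real^'n) set) x y. proper_domain D \<longrightarrow> x \<in> D \<longrightarrow> y \<in> D \<longrightarrow>
               c * half_apollonian D x y \<le> gromov_u D x y) \<longrightarrow> c \<le> 1)
       \<and> (\<forall>C::real.
            (\<forall>(D :: (real^'n) set) x y. proper_domain D \<longrightarrow> x \<in> D \<longrightarrow> y \<in> D \<longrightarrow>
               gromov_u D x y \<le> 2 * half_apollonian D x y + C) \<longrightarrow> 2 * ln 3 \<le> C)"
proof (intro conjI allI impI)
  fix D :: "(real^'n) set" and x y
  assume "proper_domain D" "x \<in> D" "y \<in> D"
  then show "half_apollonian D x y \<le> gromov_u D x y"
    and "gromov_u D x y \<le> 2 * half_apollonian D x y + 2 * ln 3"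
    by (rule half_apollonian_le_gromov_u gromov_u_le_half_apollonian)+
next
  fix c :: real
  assume "\<forall>(D :: (real^'n) set) x y. proper_domain D \<longrightarrow> x \<in> D \<longrightarrow> y \<in> D \<longrightarrow>
    c * half_apollonian D x y \<le> gromov_u D x y"
  moreover have "proper_domain (- {0 :: real^'n})"
    using assms by (intro proper_domain_punctured) simp
  ultimately show "c \<le> 1"
    by (intro multiplicative_constant_le_1[where 'a = "real^'n"]) simp
next
  fix C :: real
  assume "\<forall>(D :: (real^'n) set) x y. proper_domain D \<longrightarrow> x \<in> D \<longrightarrow> y \<in> D \<longrightarrow>
    gromov_u D x y \<le> 2 * half_apollonian D x y + C"
  moreover have "proper_domain (- {0 :: real^'n})"
    using assms by (intro proper_domain_punctured) simp
  ultimately show "2 * ln 3 \<le> C"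
    by (intro additive_constant_ge[where 'a = "real^'n"]) simp
qed

end
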